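(* Let $G_2$ be a Lie group with Lie algebra $\mathfrak g=\mathfrak h_3\ltimes sl(2,\mathbb R)$, i.e. the real Lie algebra with basis $e_1,\dots,e_6$ and nonzero brackets (up to antisymmetry) $$[e_1,e_2]=e_3,\ [e_4,e_5]=2e_5,\ [e_4,e_6]=-2e_6,\ [e_5,e_6]=e_4,\ [e_4,e_1]=e_1,\ [e_5,e_2]=e_1,\ [e_6,e_1]=e_2,\ [e_4,e_2]=-e_2 .$$ Let $P_0=\mathrm{diag}\{1,1,1,-1,-1,-1\}$ in this basis. Then: (i) $G_2$ does not admit left-invariant symplectic structures. (ii) $G_2$ has natural left-invariant semi-para-K\"ahler structures $(\Omega_{0i},P_0,G_{0i})$, $i=1,2$, of zero scalar curvature, where $$\Omega_{01}=-e^1\wedge e^4+e^2\wedge e^5+e^3\wedge e^6,\qquad \Omega_{02}=e^1\wedge e^4-e^2\wedge e^5+e^3\wedge e^6,$$ and $G_{0i}(X,Y)=\Omega_{0i}(X,P_0Y)$. (iii) $G_2$ admits the following multiparameter families of left-invariant semi-K\"ahler 2-forms compatible with $P_0$ (the $w_{ij}$ are real parameters such that the denominators are nonzero and the form is nondegenerate): $$\omega_1=e^1\wedge\Big(\tfrac{w_{16}w_{34}-w_{25}w_{36}+w_{26}w_{35}}{w_{36}}e^4+\tfrac{w_{16}w_{35}-w_{24}w_{35}+w_{25}w_{34}}{w_{36}}e^5+w_{16}e^6\Big)+e^2\wedge(w_{24}e^4+w_{25}e^5+w_{26}e^6)+e^3\wedge(w_{34}e^4+w_{35}e^5+w_{36}e^6),$$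 $$\omega_2=e^1\wedge\Big(w_{14}e^4+w_{15}e^5+\tfrac{w_{24}w_{35}-w_{25}w_{34}}{w_{35}}e^6\Big)+e^2\wedge\Big(w_{24}e^4+w_{25}e^5-\tfrac{(w_{24}w_{35}-w_{25}w_{34})w_{34}}{w_{35}^2}e^6\Big)+e^3\wedge(w_{34}e^4+w_{35}e^5),$$ $$\omega_3=e^1\wedge(w_{14}e^4+w_{15}e^5)+e^2\wedge(w_{24}e^4+w_{26}e^6)+w_{34}\,e^3\wedge e^4 .$$ Consequently, for every $\omega$ in these families, $(\omega,P_0,g_\omega)$ with $g_\omega(X,Y)=\omega(X,P_0Y)$ is a left-invariant semi-para-K\"ahler structure on $G_2$.
   Context: Left-invariant tensors on a Lie group are identified with their values on the Lie algebra $\mathfrak g$. $e^1,\dots,e^6$ is the dual basis of $e_1,\dots,e_6$, and $e^i\wedge e^j=e^i\otimes e^j-e^j\otimes e^i$. The exterior derivative $d$ is that of left-invariant forms; for a 2-form, $d\omega=0$ means $\omega([X,Y],Z)-\omega([X,Z],Y)+\omega([Y,Z],X)=0$ for all $X,Y,Z\in\mathfrak g$. A left-invariant symplectic structure is a nondegenerate 2-form $\omega$ on $\mathfrak g$ with $d\omega=0$. A left-invariant paracomplex structure is an endomorphism $P$ of $\mathfrak g$ with $P^2=\mathrm{Id}$, whose $(\pm1)$-eigenspaces have equal dimension and are subalgebras. A 2-form $\omega$ is compatible with $P$ if $\omega(PX,PY)=-\omega(X,Y)$ for all $X,Y$. In dimension 6, a semi-K\"ahler 2-form is a nondegenerate left-invariant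 2-form $\omega$ with $d(\omega^2)=0$, equivalently $\omega\wedge d\omega=0$. A left-invariant semi-para-K\"ahler structure is a triple $(\omega,P,g)$ where $P$ is a left-invariant (almost) paracomplex structure, $\omega$ is a semi-K\"ahler 2-form compatible with $P$, and $g(X,Y)=\omega(X,PY)$, a pseudo-Riemannian metric (a left-invariant almost para-Hermitian structure whose fundamental form satisfies $d(\omega^2)=0$). Scalar curvature is that of the Levi-Civita connection of the left-invariant pseudo-Riemannian metric. *)

theory Defs
  imports
    "HOL-Analysis.Analysis"
    "HOL-Combinatorics.Permutations"
    "HOL-Library.Function_Algebras"
begin

text \<open>
  Left-invariant tensors on a Lie group are identified with tensors on its Lie algebra, here
  a bracket \<^term>\<open>br :: real^'n \<Rightarrow> real^'n \<Rightarrow> real^'n\<close>.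
\<close>

definition lie_algebra :: "(real^'n \<Rightarrow> real^'n \<Rightarrow> real^'n) \<Rightarrow> bool" where
  "lie_algebra br \<longleftrightarrow> bilinear br \<and> (\<forall>X. br X X = 0) \<and>
     (\<forall>X Y Z. br X (br Y Z) + br Y (br Z X) + br Z (br X Y) = 0)"

definition subalgebra :: "(real^'n \<Rightarrow> real^'n \<Rightarrow> real^'n) \<Rightarrow> (real^'n) set \<Rightarrow> bool" where
  "subalgebra br S \<longleftrightarrow> subspace S \<and> (\<forall>X\<in>S. \<forall>Y\<in>S. br X Y \<in> S)"

section \<open>Exterior forms\<close>

text \<open>
  A \<open>k\<close>-form is evaluated on the list of its \<open>k\<close> arguments; its values on lists of any other
  length carry no meaning. Sums of forms are pointwise sums of functions.
\<close>

type_synonym 'n form = "(real^'n) list \<Rightarrow> real"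

definition is_form :: "nat \<Rightarrow> 'n::finite form \<Rightarrow> bool" where
  "is_form k \<alpha> \<longleftrightarrow>
     (\<forall>xs i. length xs = k \<and> i < k \<longrightarrow> linear (\<lambda>x. \<alpha> (xs[i := x]))) \<and>
     (\<forall>xs i j. length xs = k \<and> i < j \<and> j < k \<and> xs ! i = xs ! j \<longrightarrow> \<alpha> xs = 0)"

definition form_scale :: "real \<Rightarrow> 'n::finite form \<Rightarrow> 'n form" (infixr "\<odot>" 75) where
  "c \<odot> \<alpha> = (\<lambda>xs. c * \<alpha> xs)"

definition dual_basis :: "'n::finite \<Rightarrow> 'n form" ("\<epsilon>") where
  "\<epsilon> i = (\<lambda>xs. hd xs $ i)"

text \<open>
  The wedge of a \<open>p\<close>-form and a \<open>q\<close>-form, normalised so that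
  \<open>\<epsilon> i \<and> \<epsilon> j = \<epsilon> i \<otimes> \<epsilon> j - \<epsilon> j \<otimes> \<epsilon> i\<close>.
\<close>

definition wedge :: "nat \<Rightarrow> nat \<Rightarrow> 'n::finite form \<Rightarrow> 'n form \<Rightarrow> 'n form" where
  "wedge p q \<alpha> \<beta> = (\<lambda>xs.
     (\<Sum>\<sigma> | \<sigma> permutes {..<p + q}.
        of_int (sign \<sigma>) * \<alpha> (map (\<lambda>i. xs ! \<sigma> i) [0..<p]) * \<beta> (map (\<lambda>i. xs ! \<sigma> i) [p..<p + q]))
     / (fact p * fact q))"

abbreviation wedge11 :: "'n::finite form \<Rightarrow> 'n form \<Rightarrow> 'n form" (infixr "\<^bold>\<and>" 70) where
  "\<alpha> \<^bold>\<and> \<beta> \<equiv> wedge 1 1 \<alpha> \<beta>"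

text \<open>The exterior derivative of left-invariant forms (Chevalley--Eilenberg differential).\<close>

definition ext_d :: "(real^'n \<Rightarrow> real^'n \<Rightarrow> real^'n) \<Rightarrow> 'n::finite form \<Rightarrow> 'n form" where
  "ext_d br \<alpha> = (\<lambda>xs. \<Sum>j<length xs. \<Sum>i<j.
     (-1) ^ (i + j) * \<alpha> (br (xs ! i) (xs ! j) # nths xs (- {i, j})))"

definition closed_form :: "(real^'n \<Rightarrow> real^'n \<Rightarrow> real^'n) \<Rightarrow> nat \<Rightarrow> 'n::finite form \<Rightarrow> bool" where
  "closed_form br k \<alpha> \<longleftrightarrow> (\<forall>xs. length xs = k + 1 \<longrightarrow> ext_d br \<alpha> xs = 0)"

definition nondegenerate :: "(real^'n \<Rightarrow> real^'n \<Rightarrow> real) \<Rightarrow> bool" where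
  "nondegenerate b \<longleftrightarrow> (\<forall>X. (\<forall>Y. b X Y = 0) \<longrightarrow> X = 0)"

definition nondegenerate_form :: "'n::finite form \<Rightarrow> bool" where
  "nondegenerate_form \<omega> \<longleftrightarrow> nondegenerate (\<lambda>X Y. \<omega> [X, Y])"

section \<open>Geometric structures\<close>

definition symplectic :: "(real^'n \<Rightarrow> real^'n \<Rightarrow> real^'n) \<Rightarrow> 'n::finite form \<Rightarrow> bool" where
  "symplectic br \<omega> \<longleftrightarrow> is_form 2 \<omega> \<and> nondegenerate_form \<omega> \<and> closed_form br 2 \<omega>"

definition paracomplex :: "(real^'n \<Rightarrow> real^'n \<Rightarrow> real^'n) \<Rightarrow> (real^'n \<Rightarrow> real^'n) \<Rightarrow> bool" where
  "paracomplex br P \<longleftrightarrow> linear P \<and> P \<circ> P = id \<and>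
     dim {X. P X = X} = dim {X. P X = - X} \<and>
     subalgebra br {X. P X = X} \<and> subalgebra br {X. P X = - X}"

definition compatible :: "'n::finite form \<Rightarrow> (real^'n \<Rightarrow> real^'n) \<Rightarrow> bool" where
  "compatible \<omega> P \<longleftrightarrow> (\<forall>X Y. \<omega> [P X, P Y] = - \<omega> [X, Y])"

definition semi_kaehler :: "(real^6 \<Rightarrow> real^6 \<Rightarrow> real^6) \<Rightarrow> 6 form \<Rightarrow> bool" where
  "semi_kaehler br \<omega> \<longleftrightarrow>
     is_form 2 \<omega> \<and> nondegenerate_form \<omega> \<and> closed_form br 4 (wedge 2 2 \<omega> \<omega>)"

definition pseudo_riemannian :: "(real^'n \<Rightarrow> real^'n \<Rightarrow> real) \<Rightarrow> bool" where
  "pseudo_riemannian g \<longleftrightarrow> bilinear g \<and> (\<forall>X Y. g X Y = g Y X) \<and> nondegenerate g"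

definition assoc_metric :: "'n::finite form \<Rightarrow> (real^'n \<Rightarrow> real^'n) \<Rightarrow> real^'n \<Rightarrow> real^'n \<Rightarrow> real" where
  "assoc_metric \<omega> P X Y = \<omega> [X, P Y]"

text \<open>
  The paracomplex structure is required to be integrable, the stronger of the two possible
  conventions.
\<close>

definition semi_para_kaehler ::
  "(real^6 \<Rightarrow> real^6 \<Rightarrow> real^6) \<Rightarrow> 6 form \<Rightarrow> (real^6 \<Rightarrow> real^6) \<Rightarrow> (real^6 \<Rightarrow> real^6 \<Rightarrow> real) \<Rightarrow> bool" where
  "semi_para_kaehler br \<omega> P g \<longleftrightarrow>
     paracomplex br P \<and> semi_kaehler br \<omega> \<and> compatible \<omega> P \<and>
     g = assoc_metric \<omega> P \<and> pseudo_riemannian g"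

section \<open>Curvature of a left-invariant metric\<close>

definition is_levi_civita ::
  "(real^'n \<Rightarrow> real^'n \<Rightarrow> real^'n) \<Rightarrow> (real^'n \<Rightarrow> real^'n \<Rightarrow> real) \<Rightarrow> (real^'n \<Rightarrow> real^'n \<Rightarrow> real^'n) \<Rightarrow> bool" where
  "is_levi_civita br g nabla \<longleftrightarrow> bilinear nabla \<and>
     (\<forall>X Y. nabla X Y - nabla Y X = br X Y) \<and>
     (\<forall>X Y Z. g (nabla X Y) Z + g Y (nabla X Z) = 0)"

text \<open>
  For a Lie bracket and a pseudo-Riemannian metric the connection below exists and is unique
  (Koszul formula), so the description operator selects it.
\<close>

definition levi_civita ::
  "(real^'n \<Rightarrow> real^'n \<Rightarrow> real^'n) \<Rightarrow> (real^'n \<Rightarrow> real^'n \<Rightarrow> real) \<Rightarrow> real^'n \<Rightarrow> real^'n \<Rightarrow> real^'n" where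
  "levi_civita br g = (THE nabla. is_levi_civita br g nabla)"

definition riemann ::
  "(real^'n \<Rightarrow> real^'n \<Rightarrow> real^'n) \<Rightarrow> (real^'n \<Rightarrow> real^'n \<Rightarrow> real) \<Rightarrow>
   real^'n \<Rightarrow> real^'n \<Rightarrow> real^'n \<Rightarrow> real^'n" where
  "riemann br g X Y Z = (let D = levi_civita br g in D X (D Y Z) - D Y (D X Z) - D (br X Y) Z)"

definition ricci ::
  "(real^'n \<Rightarrow> real^'n \<Rightarrow> real^'n) \<Rightarrow> (real^'n \<Rightarrow> real^'n \<Rightarrow> real) \<Rightarrow> real^'n \<Rightarrow> real^'n \<Rightarrow> real" where
  "ricci br g Y Z = trace (matrix (\<lambda>X. riemann br g X Y Z))"

definition scalar_curvature ::
  "(real^'n \<Rightarrow> real^'n \<Rightarrow> real^'n) \<Rightarrow> (real^'n \<Rightarrow> real^'n \<Rightarrow> real) \<Rightarrow> real" where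
  "scalar_curvature br g =
     (\<Sum>i\<in>UNIV. \<Sum>j\<in>UNIV. matrix_inv (\<chi> k l. g (axis k 1) (axis l 1)) $ i $ j
        * ricci br g (axis i 1) (axis j 1))"

section \<open>The Lie algebra \<open>h\<^sub>3 \<ltimes> sl(2,\<real>)\<close>\<close>

text \<open>
  The index type \<open>6\<close> has the elements \<open>1, 2, 3, 4, 5, 6\<close>, where \<open>6 = 0\<close>.
\<close>

abbreviation basis_vec :: "6 \<Rightarrow> real^6" ("\<e>") where
  "\<e> i \<equiv> axis i 1"

definition g2_br :: "real^6 \<Rightarrow> real^6 \<Rightarrow> real^6" where
  "g2_br X Y = (let m = (\<lambda>i j. X $ i * Y $ j - X $ j * Y $ i) in
       m 1 2 *\<^sub>R \<e> 3
     + m 4 5 *\<^sub>R (2 *\<^sub>R \<e> 5)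
     + m 4 6 *\<^sub>R (- 2 *\<^sub>R \<e> 6)
     + m 5 6 *\<^sub>R \<e> 4
     + m 4 1 *\<^sub>R \<e> 1
     + m 5 2 *\<^sub>R \<e> 1
     + m 6 1 *\<^sub>R \<e> 2
     + m 4 2 *\<^sub>R (- \<e> 2))"

definition P0 :: "real^6 \<Rightarrow> real^6" where
  "P0 X = (\<chi> i. if i \<in> {1, 2, 3} then X $ i else - X $ i)"

definition Omega01 :: "6 form" where
  "Omega01 = - (\<epsilon> 1 \<^bold>\<and> \<epsilon> 4) + (\<epsilon> 2 \<^bold>\<and> \<epsilon> 5) + (\<epsilon> 3 \<^bold>\<and> \<epsilon> 6)"

definition Omega02 :: "6 form" where
  "Omega02 = (\<epsilon> 1 \<^bold>\<and> \<epsilon> 4) - (\<epsilon> 2 \<^bold>\<and> \<epsilon> 5) + (\<epsilon> 3 \<^bold>\<and> \<epsilon> 6)"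

text \<open>
  The parameters \<open>w\<^sub>i\<^sub>j\<close> are the values \<open>w i j\<close>; values not occurring in a formula are irrelevant.
\<close>

definition omega1 :: "(nat \<Rightarrow> nat \<Rightarrow> real) \<Rightarrow> 6 form" where
  "omega1 w =
     \<epsilon> 1 \<^bold>\<and> (((w 1 6 * w 3 4 - w 2 5 * w 3 6 + w 2 6 * w 3 5) / w 3 6) \<odot> \<epsilon> 4
            + ((w 1 6 * w 3 5 - w 2 4 * w 3 5 + w 2 5 * w 3 4) / w 3 6) \<odot> \<epsilon> 5
            + w 1 6 \<odot> \<epsilon> 6)
   + \<epsilon> 2 \<^bold>\<and> (w 2 4 \<odot> \<epsilon> 4 + w 2 5 \<odot> \<epsilon> 5 + w 2 6 \<odot> \<epsilon> 6)
   + \<epsilon> 3 \<^bold>\<and> (w 3 4 \<odot> \<epsilon> 4 + w 3 5 \<odot> \<epsilon> 5 + w 3 6 \<odot> \<epsilon> 6)"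

definition omega2 :: "(nat \<Rightarrow> nat \<Rightarrow> real) \<Rightarrow> 6 form" where
  "omega2 w =
     \<epsilon> 1 \<^bold>\<and> (w 1 4 \<odot> \<epsilon> 4 + w 1 5 \<odot> \<epsilon> 5
            + ((w 2 4 * w 3 5 - w 2 5 * w 3 4) / w 3 5) \<odot> \<epsilon> 6)
   + \<epsilon> 2 \<^bold>\<and> (w 2 4 \<odot> \<epsilon> 4 + w 2 5 \<odot> \<epsilon> 5
            + (- ((w 2 4 * w 3 5 - w 2 5 * w 3 4) * w 3 4 / (w 3 5)\<^sup>2)) \<odot> \<epsilon> 6)
   + \<epsilon> 3 \<^bold>\<and> (w 3 4 \<odot> \<epsilon> 4 + w 3 5 \<odot> \<epsilon> 5)"

definition omega3 :: "(nat \<Rightarrow> nat \<Rightarrow> real) \<Rightarrow> 6 form" where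
  "omega3 w =
     \<epsilon> 1 \<^bold>\<and> (w 1 4 \<odot> \<epsilon> 4 + w 1 5 \<odot> \<epsilon> 5)
   + \<epsilon> 2 \<^bold>\<and> (w 2 4 \<odot> \<epsilon> 4 + w 2 6 \<odot> \<epsilon> 6)
   + w 3 4 \<odot> (\<epsilon> 3 \<^bold>\<and> \<epsilon> 4)"

definition family1 :: "6 form set" where
  "family1 = {omega1 w | w. w 3 6 \<noteq> 0 \<and> nondegenerate_form (omega1 w)}"

definition family2 :: "6 form set" where
  "family2 = {omega2 w | w. w 3 5 \<noteq> 0 \<and> nondegenerate_form (omega2 w)}"

definition family3 :: "6 form set" where
  "family3 = {omega3 w | w. nondegenerate_form (omega3 w)}"

section \<open>Consistency checks\<close>

lemma UNIV_6: "(UNIV :: 6 set) = {1, 2, 3, 4, 5, 6}"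
proof -
  have "card {1, 2, 3, 4, 5, 6 :: 6} = CARD(6)" by simp
  then show ?thesis by (metis card_subset_eq finite subset_UNIV)
qed

lemma g2_br_table:
  "g2_br (\<e> 1) (\<e> 2) = \<e> 3" "g2_br (\<e> 4) (\<e> 5) = 2 *\<^sub>R \<e> 5" "g2_br (\<e> 4) (\<e> 6) = - 2 *\<^sub>R \<e> 6"
  "g2_br (\<e> 5) (\<e> 6) = \<e> 4" "g2_br (\<e> 4) (\<e> 1) = \<e> 1" "g2_br (\<e> 5) (\<e> 2) = \<e> 1"
  "g2_br (\<e> 6) (\<e> 1) = \<e> 2" "g2_br (\<e> 4) (\<e> 2) = - \<e> 2"
  "g2_br (\<e> 1) (\<e> 3) = 0" "g2_br (\<e> 2) (\<e> 3) = 0" "g2_br (\<e> 3) (\<e> 4) = 0"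
  "g2_br (\<e> 3) (\<e> 5) = 0" "g2_br (\<e> 3) (\<e> 6) = 0" "g2_br (\<e> 1) (\<e> 5) = 0" "g2_br (\<e> 2) (\<e> 6) = 0"
  by (simp_all add: g2_br_def axis_def)

lemma lie_algebra_g2: "lie_algebra g2_br"
proof -
  have "linear (\<lambda>x. g2_br x y)" "linear (\<lambda>y. g2_br x y)" for x y
    by (intro linearI; simp add: g2_br_def vec_eq_iff axis_def algebra_simps)+
  then have "bilinear g2_br" by (simp add: bilinear_def)
  then show ?thesis
    unfolding lie_algebra_def
    by (auto simp: g2_br_def vec_eq_iff axis_def algebra_simps)
qed

lemma wedge11_eq: "wedge 1 1 \<alpha> \<beta> [X, Y] = \<alpha> [X] * \<beta> [Y] - \<alpha> [Y] * \<beta> [X]"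
proof -
  have perms: "{\<sigma>. \<sigma> permutes {..<1 + 1}} = {id, Transposition.transpose 0 (1::nat)}"
    by (auto simp: numeral_2_eq_2 lessThan_Suc permutes_doubleton_iff insert_commute)
  have neq: "id \<noteq> Transposition.transpose 0 (1::nat)"
    by (metis id_apply transpose_apply_first zero_neq_one)
  show ?thesis
    unfolding wedge_def perms using neq by (simp add: sign_swap_id)
qed

lemma ext_d_2form:
  "ext_d br \<omega> [X, Y, Z] = - \<omega> [br X Y, Z] + \<omega> [br X Z, Y] - \<omega> [br Y Z, X]"
  by (simp add: ext_d_def numeral_3_eq_3 nths_Cons lessThan_Suc)

end

theory Submission
  imports Defs
begin

text \<open>
  The algebra is perfect and \<open>e\<^sub>3\<close> is central, so a closed 2-form has \<open>e\<^sub>3\<close> in its radical.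
  For a 2-form \<open>\<omega>\<close> compatible with \<open>P\<^sub>0\<close>, the 5-form \<open>d(\<omega>\<^sup>2)\<close> is determined by its values on six
  increasing tuples of basis vectors; four of these values vanish identically and the other two are
  quadratic equations in the coefficients \<open>w\<^sub>i\<^sub>j\<close>, which the three families satisfy. The forms
  \<open>\<Omega>\<^sub>0\<^sub>1\<close> and \<open>\<Omega>\<^sub>0\<^sub>2\<close> belong to the first family. Their metrics are treated together through a sign
  \<open>s = \<plusminus>1\<close>; the inverse metric pairs \<open>e\<^sub>i\<close> only with \<open>e\<^sub>i\<^sub>+\<^sub>3\<close>, and the Ricci tensor vanishes on these pairs.
\<close>

lemma sum_UNIV_6: "sum f (UNIV :: 6 set) = f 1 + f 2 + f 3 + f 4 + f 5 + f 6"
  unfolding UNIV_6 by (simp add: add.assoc)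

lemma forall_6: "(\<forall>i::6. P i) \<longleftrightarrow> P 1 \<and> P 2 \<and> P 3 \<and> P 4 \<and> P 5 \<and> P 6"
  using UNIV_6 by (metis (full_types) UNIV_I empty_iff insert_iff)

section \<open>Alternating forms\<close>

text \<open>
  Vanishing is only required for equal adjacent arguments: for \<open>d(\<omega>\<^sup>2)\<close> the terms then cancel in
  pairs without any use of antisymmetry.
\<close>

definition alternating :: "nat \<Rightarrow> 'n::finite form \<Rightarrow> bool" where
  "alternating k \<alpha> \<longleftrightarrow>
     (\<forall>us vs. length us + length vs + 1 = k \<longrightarrow> linear (\<lambda>x. \<alpha> (us @ x # vs))) \<and>
     (\<forall>us x vs. length us + length vs + 2 = k \<longrightarrow> \<alpha> (us @ x # x # vs) = 0)"

lemma alternatingD: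
  assumes "alternating k \<alpha>"
  shows "length us + length vs + 1 = k \<Longrightarrow> linear (\<lambda>x. \<alpha> (us @ x # vs))"
    and "length us + length vs + 2 = k \<Longrightarrow> \<alpha> (us @ x # x # vs) = 0"
  using assms by (auto simp: alternating_def)

text \<open>Polarisation: the value on the adjacent pair \<open>x + y\<close>, \<open>x + y\<close>
  is expanded by additivity.\<close>

lemma alternating_swap:
  fixes \<alpha> :: "'n::finite form"
  assumes \<alpha>: "alternating k \<alpha>"
    and len: "length us + length vs + 2 = k"
  shows "\<alpha> (us @ x # y # vs) = - \<alpha> (us @ y # x # vs)"
proof -
  have 1: "\<alpha> (us @ (p + q) # r # vs) = \<alpha> (us @ p # r # vs) + \<alpha> (us @ q # r # vs)" for p q r
    using linear_add[OF alternatingD(1)[OF \<alpha>, of us "r # vs"]] len by simp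
  have 2: "\<alpha> (us @ r # (p + q) # vs) = \<alpha> (us @ r # p # vs) + \<alpha> (us @ r # q # vs)" for p q r
    using linear_add[OF alternatingD(1)[OF \<alpha>, of "us @ [r]" vs]] len by simp
  have "\<alpha> (us @ (x + y) # (x + y) # vs) = 0" "\<alpha> (us @ x # x # vs) = 0" "\<alpha> (us @ y # y # vs) = 0"
    using alternatingD(2)[OF \<alpha> len] by blast+
  then show ?thesis unfolding 1 2 by simp
qed

text \<open>Tracking only whether the value vanishes avoids the sign of the rearrangement. The
  prefix \<open>us\<close> stays fixed and grows by one entry in each induction step, once the head
  of \<open>xs\<close> has been brought to the front of \<open>ys\<close>.\<close>

lemma alternating_zero_perm:
  fixes \<alpha> :: "'n::finite form"
  assumes \<alpha>: "alternating k \<alpha>"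
    and "length us + length xs = k" and "mset xs = mset ys"
  shows "\<alpha> (us @ xs) = 0 \<longleftrightarrow> \<alpha> (us @ ys) = 0"
  using assms(2,3)
proof (induction xs arbitrary: us ys)
  case Nil
  then show ?case by simp
next
  case (Cons x xs)
  from Cons.prems(2) obtain ps qs where ys: "ys = ps @ x # qs"
    by (metis list.set_intros(1) mset_eq_setD split_list)
  have lenys: "length ys = length (x # xs)"
    using Cons.prems(2) by (metis mset_eq_length)
  \<comment> \<open>\<open>x\<close> travels left across \<open>ps\<close> by adjacent swaps, each
    of which only changes the sign.\<close>
  have move: "\<alpha> (vs @ ps @ x # qs) = 0 \<longleftrightarrow> \<alpha> (vs @ x # ps @ qs) = 0"
    if "length vs + length ps + length qs + 1 = k" for vs ps qs
    using that
  proof (induction ps arbitrary: vs)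
    case (Cons p ps)
    have "\<alpha> (vs @ (p # ps) @ x # qs) = 0 \<longleftrightarrow> \<alpha> (vs @ p # x # ps @ qs) = 0"
      using Cons.IH[of "vs @ [p]"] Cons.prems by simp
    also have "\<dots> \<longleftrightarrow> \<alpha> (vs @ x # p # ps @ qs) = 0"
      using alternating_swap[OF \<alpha>, of vs "ps @ qs" p x] Cons.prems by simp
    finally show ?case by simp
  qed simp
  have "\<alpha> (us @ ys) = 0 \<longleftrightarrow> \<alpha> ((us @ [x]) @ ps @ qs) = 0"
    using move[of us ps qs] Cons.prems(1) lenys by (simp add: ys)
  also have "\<dots> \<longleftrightarrow> \<alpha> ((us @ [x]) @ xs) = 0"
    using Cons.IH[of "us @ [x]" "ps @ qs"] Cons.prems by (simp add: ys)
  finally show ?case by simp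
qed

text \<open>By multilinearity only tuples of basis vectors matter; those with a repeated index
  vanish, and the others are rearrangements of one chosen listing of their index set. So one
  evaluation per \<open>k\<close>-element set of indices suffices.\<close>

lemma alternating_form_eq_0:
  fixes \<alpha> :: "'n::finite form"
  assumes \<alpha>: "alternating k \<alpha>"
    and base: "\<And>S. card S = k \<Longrightarrow>
      \<exists>js. distinct js \<and> set js = S \<and> \<alpha> (map (\<lambda>i. axis i 1) js) = 0"
    and len: "length xs = k"
  shows "\<alpha> xs = 0"
proof -
  let ?e = "\<lambda>i. axis i (1::real) :: real^'n"
  have basis: "\<alpha> (map ?e is) = 0" if len: "length is = k" for "is"
  proof (cases "distinct is")
    case True
    then obtain js where "distinct js" "set js = set is" "\<alpha> (map ?e js) = 0"
      using base[of "set is"] len distinct_card by metis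
    moreover from this have "mset (map ?e is) = mset (map ?e js)"
      using True by (metis mset_map set_eq_iff_mset_eq_distinct)
    ultimately show ?thesis
      using alternating_zero_perm[OF \<alpha>, of "[]" "map ?e is" "map ?e js"] len by simp
  next
    case False
    then obtain as bs cs i where "is": "is = as @ [i] @ bs @ [i] @ cs"
      using not_distinct_decomp by blast
    \<comment> \<open>The two equal entries are brought to the front, where they are
      adjacent.\<close>
    have "\<alpha> ([] @ map ?e is) = 0 \<longleftrightarrow> \<alpha> ([] @ (?e i # ?e i # map ?e (as @ bs @ cs))) = 0"
      using len by (intro alternating_zero_perm[OF \<alpha>]) (simp_all add: "is")
    then show ?thesis
      using alternatingD(2)[OF \<alpha>, of "[]" "map ?e (as @ bs @ cs)"] len "is" by simp
  qed
  \<comment> \<open>The arguments are expanded in the basis from left to right: \<open>is\<close>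
    indexes those already replaced by basis vectors, \<open>vs\<close> holds the rest.\<close>
  have "\<alpha> (map ?e is @ vs) = 0" if "length is + length vs = k" for "is" vs
    using that
  proof (induction vs arbitrary: "is")
    case Nil
    then show ?case using basis by simp
  next
    case (Cons x vs)
    have l: "linear (\<lambda>x. \<alpha> (map ?e is @ x # vs))"
      using alternatingD(1)[OF \<alpha>] Cons.prems by simp
    have "\<alpha> (map ?e is @ x # vs) = (\<lambda>x. \<alpha> (map ?e is @ x # vs)) (\<Sum>i\<in>UNIV. (x $ i) *\<^sub>R ?e i)"
      using basis_expansion[of x] by (simp add: scalar_mult_eq_scaleR)
    also have "\<dots> = (\<Sum>i\<in>UNIV. x $ i * \<alpha> (map ?e (is @ [i]) @ vs))"
      by (subst linear_sum[OF l]) (simp add: linear_cmul[OF l])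
    also have "\<dots> = 0"
      using Cons.IH[of "is @ [_]"] Cons.prems by simp
    finally show ?case .
  qed
  from this[of "[]" xs] show ?thesis using len by simp
qed

section \<open>2-forms, their wedge square and its exterior derivative\<close>

lemma is_form_2I:
  assumes "bilinear (\<lambda>X Y. \<omega> [X, Y])" and "\<And>X. \<omega> [X, X] = 0"
  shows "is_form 2 \<omega>"
  unfolding is_form_def
proof (intro conjI allI impI)
  fix xs :: "(real^'a) list" and i :: nat
  assume "length xs = 2 \<and> i < 2"
  then obtain a b where "xs = [a, b]" "i = 0 \<or> i = 1"
    by (auto simp: length_Suc_conv numeral_2_eq_2 less_Suc_eq)
  then show "linear (\<lambda>x. \<omega> (xs[i := x]))"
    using assms(1) by (auto simp: bilinear_def)
next
  fix xs :: "(real^'a) list" and i j :: nat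
  assume "length xs = 2 \<and> i < j \<and> j < 2 \<and> xs ! i = xs ! j"
  then show "\<omega> xs = 0"
    using assms(2) by (auto simp: length_Suc_conv numeral_2_eq_2 less_Suc_eq)
qed

lemma is_form_2D:
  assumes "is_form 2 \<omega>"
  shows "bilinear (\<lambda>X Y. \<omega> [X, Y])" and "\<omega> [X, X] = 0" and "\<omega> [X, Y] = - \<omega> [Y, X]"
proof -
  show bil: "bilinear (\<lambda>X Y. \<omega> [X, Y])"
    using assms[unfolded is_form_def, THEN conjunct1, rule_format, of "[_, _]" 0]
      assms[unfolded is_form_def, THEN conjunct1, rule_format, of "[_, _]" 1]
    by (simp add: bilinear_def)
  have alt: "\<omega> [X, X] = 0" for X
    using assms[unfolded is_form_def, THEN conjunct2, rule_format, of "[X, X]" 0 1] by simp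
  then show "\<omega> [X, X] = 0" .
  have "\<omega> [X + Y, X + Y] = 0" by (rule alt)
  then show "\<omega> [X, Y] = - \<omega> [Y, X]"
    using alt[of X] alt[of Y] by (simp add: bilinear_ladd[OF bil] bilinear_radd[OF bil])
qed

text \<open>The wedge reads only the entries 0 and 1. Lists of every length are covered because
  forms are later equated as functions, hence also at lists of the wrong length.\<close>

lemma wedge11_apply: "wedge 1 1 \<alpha> \<beta> xs = \<alpha> [xs ! 0] * \<beta> [xs ! 1] - \<alpha> [xs ! 1] * \<beta> [xs ! 0]"
proof -
  have "wedge 1 1 \<alpha> \<beta> xs = wedge 1 1 \<alpha> \<beta> [xs ! 0, xs ! 1]"
    unfolding wedge_def
  proof (intro arg_cong2[of _ _ _ _ "(/)"] refl sum.cong)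
    fix \<sigma> :: "nat \<Rightarrow> nat"
    assume "\<sigma> \<in> {\<sigma>. \<sigma> permutes {..<1 + 1}}"
    then have "\<sigma> 0 < 2" "\<sigma> 1 < 2"
      using permutes_in_image[of \<sigma> "{..<2}"] by (simp_all add: numeral_2_eq_2)
    then have "[xs ! 0, xs ! 1] ! \<sigma> 0 = xs ! \<sigma> 0" "[xs ! 0, xs ! 1] ! \<sigma> 1 = xs ! \<sigma> 1"
      by (auto simp: less_2_cases_iff)
    then show "of_int (sign \<sigma>) * \<alpha> (map (\<lambda>i. xs ! \<sigma> i) [0..<1]) * \<beta> (map (\<lambda>i. xs ! \<sigma> i) [1..<1 + 1]) =
      of_int (sign \<sigma>) * \<alpha> (map (\<lambda>i. [xs ! 0, xs ! 1] ! \<sigma> i) [0..<1]) *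
        \<beta> (map (\<lambda>i. [xs ! 0, xs ! 1] ! \<sigma> i) [1..<1 + 1])"
      by simp
  qed
  then show ?thesis by (simp only: wedge11_eq)
qed

text \<open>Each of the three splittings of the arguments into two pairs comes from 8 of the 24
  permutations, all with the same contribution; dividing by \<open>fact 2 * fact 2\<close> leaves
  the factor 2.\<close>

lemma wedge22_square:
  assumes "is_form 2 \<omega>"
  shows "wedge 2 2 \<omega> \<omega> [a, b, c, d] =
    2 * (\<omega> [a, b] * \<omega> [c, d] - \<omega> [a, c] * \<omega> [b, d] + \<omega> [a, d] * \<omega> [b, c])"
proof -
  have S: "{..<2 + 2} = {0, 1, 2, 3::nat}" by auto
  have f0: "finite {1, 2, 3::nat}" "0 \<notin> {1, 2, 3::nat}"
    and f1: "finite {2, 3::nat}" "1 \<notin> {2, 3::nat}"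
    and f2: "finite {3::nat}" "2 \<notin> {3::nat}" by auto
  note skew = is_form_2D(3)[OF assms]
  have *: "\<omega> [b, a] = - \<omega> [a, b]" "\<omega> [c, a] = - \<omega> [a, c]" "\<omega> [d, a] = - \<omega> [a, d]"
    "\<omega> [c, b] = - \<omega> [b, c]" "\<omega> [d, b] = - \<omega> [b, d]" "\<omega> [d, c] = - \<omega> [c, d]"
    by (rule skew)+
  have u: "[0..<2] = [0, 1::nat]" "[2..<2+2] = [2, 3::nat]" by (simp_all add: upt_rec)
  show ?thesis
    unfolding wedge_def S u
    \<comment> \<open>A permutation of \<open>insert a S\<close> is a permutation of
      \<open>S\<close> followed by a transposition of \<open>a\<close> with some element or by the
      identity. Peeling off three elements enumerates all 24.\<close>
    unfolding sum_over_permutations_insert[OF f0]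
    unfolding sum_over_permutations_insert[OF f1]
    unfolding sum_over_permutations_insert[OF f2]
    unfolding permutes_sing
    by (simp add: sign_swap_id permutation_swap_id sign_compose permutation_compose *  transpose_def fact_numeral)
qed

lemma ext_d_4form:
  "ext_d br \<beta> [a, b, c, d, e] =
    - \<beta> [br a b, c, d, e] + \<beta> [br a c, b, d, e] - \<beta> [br a d, b, c, e] + \<beta> [br a e, b, c, d]
    - \<beta> [br b c, a, d, e] + \<beta> [br b d, a, c, e] - \<beta> [br b e, a, c, d]
    - \<beta> [br c d, a, b, e] + \<beta> [br c e, a, b, d] - \<beta> [br d e, a, b, c]"
  by (simp add: ext_d_def eval_nat_numeral nths_Cons lessThan_Suc)

text \<open>Turns the splittings quantified over in \<open>alternating 5\<close> into explicit
  lists, to which \<open>ext_d_4form\<close> applies.\<close>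

lemma append_Cons_length_5_cases:
  assumes "length us + length vs + 1 = 5"
  obtains b c d e where "us = []" "vs = [b, c, d, e]"
  | a c d e where "us = [a]" "vs = [c, d, e]"
  | a b d e where "us = [a, b]" "vs = [d, e]"
  | a b c e where "us = [a, b, c]" "vs = [e]"
  | a b c d where "us = [a, b, c, d]" "vs = []"
proof -
  have "length us = 0 \<or> length us = 1 \<or> length us = 2 \<or> length us = 3 \<or> length us = 4"
    "length vs = 4 - length us"
    using assms by linarith+
  then show ?thesis
    using that by (auto simp: length_Suc_conv eval_nat_numeral)
qed

text \<open>When two adjacent arguments equal \<open>x\<close>, the term with \<open>br x x\<close>
  is zero, the terms bracketing \<open>x\<close> with another argument cancel in pairs, and the
  remaining terms contain \<open>x\<close>, \<open>x\<close> as adjacent arguments of the wedge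
  square.\<close>

lemma alternating_ext_d_square:
  fixes \<omega> :: "'n::finite form"
  assumes br: "bilinear br" "\<And>X. br X X = 0" and \<omega>: "is_form 2 \<omega>"
  shows "alternating 5 (ext_d br (wedge 2 2 \<omega> \<omega>))"
proof -
  let ?\<beta> = "wedge 2 2 \<omega> \<omega>"
  note bil = is_form_2D(1)[OF \<omega>]
  note sq = wedge22_square[OF \<omega>]
  note w_lin = bilinear_ladd[OF bil] bilinear_radd[OF bil] bilinear_lmul[OF bil]
    bilinear_rmul[OF bil] bilinear_lzero[OF bil]
  have b_add: "?\<beta> [x + y, b, c, d] = ?\<beta> [x, b, c, d] + ?\<beta> [y, b, c, d]"
    "?\<beta> [a, x + y, c, d] = ?\<beta> [a, x, c, d] + ?\<beta> [a, y, c, d]"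
    "?\<beta> [a, b, x + y, d] = ?\<beta> [a, b, x, d] + ?\<beta> [a, b, y, d]"
    "?\<beta> [a, b, c, x + y] = ?\<beta> [a, b, c, x] + ?\<beta> [a, b, c, y]" for x y a b c d
    by (simp_all add: sq w_lin algebra_simps)
  have b_mul: "?\<beta> [r *\<^sub>R x, b, c, d] = r * ?\<beta> [x, b, c, d]"
    "?\<beta> [a, r *\<^sub>R x, c, d] = r * ?\<beta> [a, x, c, d]"
    "?\<beta> [a, b, r *\<^sub>R x, d] = r * ?\<beta> [a, b, x, d]"
    "?\<beta> [a, b, c, r *\<^sub>R x] = r * ?\<beta> [a, b, c, x]" for r x a b c d
    by (simp_all add: sq w_lin algebra_simps)
  \<comment> \<open>The bracket always occupies the first slot of \<open>?\<beta>\<close>, so a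
    repeated argument can only sit in slots 2, 3 or 3, 4.\<close>
  have b_alt: "?\<beta> [0, b, c, d] = 0" "?\<beta> [a, x, x, d] = 0" "?\<beta> [a, b, x, x] = 0" for x a b c d
    by (simp_all add: sq w_lin is_form_2D(2)[OF \<omega>])
  note lin = b_add b_mul bilinear_ladd[OF br(1)] bilinear_radd[OF br(1)]
    bilinear_lmul[OF br(1)] bilinear_rmul[OF br(1)]
  show ?thesis
    unfolding alternating_def
  proof (intro conjI allI impI)
    fix us vs :: "(real^'n) list"
    assume "length us + length vs + 1 = 5"
    then show "linear (\<lambda>x. ext_d br ?\<beta> (us @ x # vs))"
      by (cases rule: append_Cons_length_5_cases; intro linearI)
        (simp_all add: ext_d_4form lin right_diff_distrib distrib_left)
  next
    fix us vs :: "(real^'n) list" and x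
    assume "length us + length vs + 2 = 5"
    then have "length us + length (x # vs) + 1 = 5" by simp
    then show "ext_d br ?\<beta> (us @ x # x # vs) = 0"
      by (cases rule: append_Cons_length_5_cases) (simp_all add: ext_d_4form b_alt br(2))
  qed
qed

section \<open>The bracket of \<open>h\<^sub>3 \<ltimes> sl(2,\<real>)\<close>\<close>

lemma g2_br_basis:
  "g2_br (\<e> 1) (\<e> 1) = 0" "g2_br (\<e> 1) (\<e> 2) = \<e> 3" "g2_br (\<e> 1) (\<e> 3) = 0"
  "g2_br (\<e> 1) (\<e> 4) = - \<e> 1" "g2_br (\<e> 1) (\<e> 5) = 0" "g2_br (\<e> 1) (\<e> 6) = - \<e> 2"
  "g2_br (\<e> 2) (\<e> 1) = - \<e> 3" "g2_br (\<e> 2) (\<e> 2) = 0" "g2_br (\<e> 2) (\<e> 3) = 0"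
  "g2_br (\<e> 2) (\<e> 4) = \<e> 2" "g2_br (\<e> 2) (\<e> 5) = - \<e> 1" "g2_br (\<e> 2) (\<e> 6) = 0"
  "g2_br (\<e> 3) (\<e> 1) = 0" "g2_br (\<e> 3) (\<e> 2) = 0" "g2_br (\<e> 3) (\<e> 3) = 0"
  "g2_br (\<e> 3) (\<e> 4) = 0" "g2_br (\<e> 3) (\<e> 5) = 0" "g2_br (\<e> 3) (\<e> 6) = 0"
  "g2_br (\<e> 4) (\<e> 1) = \<e> 1" "g2_br (\<e> 4) (\<e> 2) = - \<e> 2" "g2_br (\<e> 4) (\<e> 3) = 0"
  "g2_br (\<e> 4) (\<e> 4) = 0" "g2_br (\<e> 4) (\<e> 5) = 2 *\<^sub>R \<e> 5" "g2_br (\<e> 4) (\<e> 6) = - 2 *\<^sub>R \<e> 6"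
  "g2_br (\<e> 5) (\<e> 1) = 0" "g2_br (\<e> 5) (\<e> 2) = \<e> 1" "g2_br (\<e> 5) (\<e> 3) = 0"
  "g2_br (\<e> 5) (\<e> 4) = - 2 *\<^sub>R \<e> 5" "g2_br (\<e> 5) (\<e> 5) = 0" "g2_br (\<e> 5) (\<e> 6) = \<e> 4"
  "g2_br (\<e> 6) (\<e> 1) = \<e> 2" "g2_br (\<e> 6) (\<e> 2) = 0" "g2_br (\<e> 6) (\<e> 3) = 0"
  "g2_br (\<e> 6) (\<e> 4) = 2 *\<^sub>R \<e> 6" "g2_br (\<e> 6) (\<e> 5) = - \<e> 4" "g2_br (\<e> 6) (\<e> 6) = 0"
  by (simp_all add: g2_br_def axis_def)

lemma bilinear_g2: "bilinear g2_br" and g2_br_self: "g2_br X X = 0"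
  using lie_algebra_g2 by (auto simp: lie_algebra_def)

lemma vec6_expansion:
  fixes X :: "real^6"
  shows "X = X $ 1 *\<^sub>R \<e> 1 + X $ 2 *\<^sub>R \<e> 2 + X $ 3 *\<^sub>R \<e> 3 + X $ 4 *\<^sub>R \<e> 4 + X $ 5 *\<^sub>R \<e> 5 + X $ 6 *\<^sub>R \<e> 6"
  using basis_expansion[of X] by (simp add: sum_UNIV_6 scalar_mult_eq_scaleR)

lemma P0_basis:
  "P0 (\<e> 1) = \<e> 1" "P0 (\<e> 2) = \<e> 2" "P0 (\<e> 3) = \<e> 3"
  "P0 (\<e> 4) = - \<e> 4" "P0 (\<e> 5) = - \<e> 5" "P0 (\<e> 6) = - \<e> 6"
  by (simp_all add: P0_def vec_eq_iff axis_def forall_6)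

lemma P0_nth:
  "P0 X $ 1 = X $ 1" "P0 X $ 2 = X $ 2" "P0 X $ 3 = X $ 3"
  "P0 X $ 4 = - X $ 4" "P0 X $ 5 = - X $ 5" "P0 X $ 6 = - X $ 6"
  by (simp_all add: P0_def)

lemma g2_br_nth:
  "g2_br X Y $ 1 = X $ 4 * Y $ 1 - X $ 1 * Y $ 4 + (X $ 5 * Y $ 2 - X $ 2 * Y $ 5)"
  "g2_br X Y $ 2 = X $ 6 * Y $ 1 - X $ 1 * Y $ 6 - (X $ 4 * Y $ 2 - X $ 2 * Y $ 4)"
  "g2_br X Y $ 3 = X $ 1 * Y $ 2 - X $ 2 * Y $ 1"
  "g2_br X Y $ 4 = X $ 5 * Y $ 6 - X $ 6 * Y $ 5"
  "g2_br X Y $ 5 = 2 * (X $ 4 * Y $ 5 - X $ 5 * Y $ 4)"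
  "g2_br X Y $ 6 = - 2 * (X $ 4 * Y $ 6 - X $ 6 * Y $ 4)"
  by (simp_all add: g2_br_def axis_def)

section \<open>Symplectic structures\<close>

text \<open>In \<open>ext_d br \<omega> [Z, X, Y]\<close> with \<open>Z\<close> central, the only
  surviving term is the one with \<open>br X Y\<close>.\<close>

lemma closed_2form_center:
  assumes "is_form 2 \<omega>" and "closed_form br 2 \<omega>" and "\<And>X. br Z X = 0"
  shows "\<omega> [br X Y, Z] = 0"
proof -
  have "ext_d br \<omega> [Z, X, Y] = 0"
    using assms(2) by (simp add: closed_form_def)
  then show ?thesis
    using assms(3) bilinear_lzero[OF is_form_2D(1)[OF assms(1)]] by (simp add: ext_d_2form)
qed

lemma not_symplectic_g2: "\<not> symplectic g2_br \<omega>"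
proof
  assume "symplectic g2_br \<omega>"
  then have form: "is_form 2 \<omega>" and nondeg: "nondegenerate_form \<omega>" and closed: "closed_form g2_br 2 \<omega>"
    by (auto simp: symplectic_def)
  note bil = is_form_2D(1)[OF form]
  have "g2_br (\<e> 3) X = 0" for X
    by (simp add: vec_eq_iff forall_6 g2_br_nth axis_def)
  then have *: "\<omega> [g2_br X Y, \<e> 3] = 0" for X Y
    by (rule closed_2form_center[OF form closed])
  \<comment> \<open>Perfectness made explicit: every basis vector is a nonzero multiple of a bracket
    of two basis vectors.\<close>
  have "\<omega> [\<e> 1, \<e> 3] = 0" "\<omega> [\<e> 2, \<e> 3] = 0" "\<omega> [\<e> 3, \<e> 3] = 0"
    "\<omega> [\<e> 4, \<e> 3] = 0" "\<omega> [\<e> 5, \<e> 3] = 0" "\<omega> [\<e> 6, \<e> 3] = 0"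
    using *[of "\<e> 4" "\<e> 1"] *[of "\<e> 6" "\<e> 1"] *[of "\<e> 1" "\<e> 2"]
      *[of "\<e> 5" "\<e> 6"] *[of "\<e> 4" "\<e> 5"] *[of "\<e> 4" "\<e> 6"]
    by (simp_all add: g2_br_basis bilinear_lmul[OF bil] bilinear_lneg[OF bil])
  then have "\<omega> [X, \<e> 3] = 0" for X
    by (subst vec6_expansion) (simp add: bilinear_ladd[OF bil] bilinear_lmul[OF bil])
  then have "\<omega> [\<e> 3, X] = 0" for X
    using is_form_2D(3)[OF form, of "\<e> 3" X] by simp
  then have "\<e> 3 = 0"
    using nondeg unfolding nondegenerate_form_def nondegenerate_def by blast
  then show False
    by (simp add: axis_eq_0_iff)
qed

section \<open>Semi-para-Kaehler structures\<close>

text \<open>\<open>eq1\<close> is the vanishing of the derivative of the square on the basis tuple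
  without \<open>\<e> 2\<close>, and \<open>eq2\<close> its vanishing on the tuple without
  \<open>\<e> 1\<close>. On the other four tuples all terms cancel.\<close>

lemma closed_square_if_compatible:
  assumes form: "is_form 2 \<omega>" and compat: "compatible \<omega> P0"
    and eq1: "\<omega> [\<e> 1, \<e> 5] * \<omega> [\<e> 3, \<e> 6] + \<omega> [\<e> 2, \<e> 4] * \<omega> [\<e> 3, \<e> 5]
      = \<omega> [\<e> 1, \<e> 6] * \<omega> [\<e> 3, \<e> 5] + \<omega> [\<e> 2, \<e> 5] * \<omega> [\<e> 3, \<e> 4]"
    and eq2: "\<omega> [\<e> 2, \<e> 5] * \<omega> [\<e> 3, \<e> 6] + \<omega> [\<e> 1, \<e> 4] * \<omega> [\<e> 3, \<e> 6]
      = \<omega> [\<e> 2, \<e> 6] * \<omega> [\<e> 3, \<e> 5] + \<omega> [\<e> 1, \<e> 6] * \<omega> [\<e> 3, \<e> 4]"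
  shows "closed_form g2_br 4 (wedge 2 2 \<omega> \<omega>)"
proof -
  note bil = is_form_2D(1)[OF form]
  note w_lin = bilinear_lmul[OF bil] bilinear_lneg[OF bil] bilinear_lzero[OF bil]
    bilinear_rneg[OF bil] is_form_2D(2)[OF form]
  have c: "\<omega> [P0 X, P0 Y] = - \<omega> [X, Y]" for X Y
    using compat by (simp add: compatible_def)
  \<comment> \<open>On two vectors of the same eigenspace, compatibility reads \<omega>(X,Y) =
    -\<omega>(X,Y).\<close>
  have zero: "\<omega> [\<e> 1, \<e> 2] = 0" "\<omega> [\<e> 1, \<e> 3] = 0" "\<omega> [\<e> 2, \<e> 3] = 0"
    "\<omega> [\<e> 4, \<e> 5] = 0" "\<omega> [\<e> 4, \<e> 6] = 0" "\<omega> [\<e> 5, \<e> 6] = 0"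
    using c[of "\<e> 1" "\<e> 2"] c[of "\<e> 1" "\<e> 3"] c[of "\<e> 2" "\<e> 3"]
      c[of "\<e> 4" "\<e> 5"] c[of "\<e> 4" "\<e> 6"] c[of "\<e> 5" "\<e> 6"]
    by (simp_all add: P0_basis w_lin)
  note skew = is_form_2D(3)[OF form]
  have zero': "\<omega> [\<e> 2, \<e> 1] = 0" "\<omega> [\<e> 3, \<e> 1] = 0" "\<omega> [\<e> 3, \<e> 2] = 0"
    "\<omega> [\<e> 5, \<e> 4] = 0" "\<omega> [\<e> 6, \<e> 4] = 0" "\<omega> [\<e> 6, \<e> 5] = 0"
    using zero skew[of "\<e> 2" "\<e> 1"] skew[of "\<e> 3" "\<e> 1"] skew[of "\<e> 3" "\<e> 2"]
      skew[of "\<e> 5" "\<e> 4"] skew[of "\<e> 6" "\<e> 4"] skew[of "\<e> 6" "\<e> 5"]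
    by simp_all
  have flip: "\<omega> [\<e> 4, \<e> 1] = - \<omega> [\<e> 1, \<e> 4]" "\<omega> [\<e> 5, \<e> 1] = - \<omega> [\<e> 1, \<e> 5]"
    "\<omega> [\<e> 6, \<e> 1] = - \<omega> [\<e> 1, \<e> 6]" "\<omega> [\<e> 4, \<e> 2] = - \<omega> [\<e> 2, \<e> 4]"
    "\<omega> [\<e> 5, \<e> 2] = - \<omega> [\<e> 2, \<e> 5]" "\<omega> [\<e> 6, \<e> 2] = - \<omega> [\<e> 2, \<e> 6]"
    "\<omega> [\<e> 4, \<e> 3] = - \<omega> [\<e> 3, \<e> 4]" "\<omega> [\<e> 5, \<e> 3] = - \<omega> [\<e> 3, \<e> 5]"
    "\<omega> [\<e> 6, \<e> 3] = - \<omega> [\<e> 3, \<e> 6]"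
    by (rule skew)+
  let ?\<alpha> = "ext_d g2_br (wedge 2 2 \<omega> \<omega>)"
  note eval = ext_d_4form g2_br_basis wedge22_square[OF form] w_lin zero zero' flip
  have basis: "?\<alpha> (map \<e> [2, 3, 4, 5, 6]) = 0" "?\<alpha> (map \<e> [1, 3, 4, 5, 6]) = 0"
    "?\<alpha> (map \<e> [1, 2, 4, 5, 6]) = 0" "?\<alpha> (map \<e> [1, 2, 3, 5, 6]) = 0"
    "?\<alpha> (map \<e> [1, 2, 3, 4, 6]) = 0" "?\<alpha> (map \<e> [1, 2, 3, 4, 5]) = 0"
    using eq1 eq2 by (simp_all add: eval algebra_simps)
  \<comment> \<open>A set of five indices omits exactly one index \<open>m\<close>, and the tuples
    in \<open>basis\<close> are listed by the omitted index.\<close>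
  have "\<exists>js. distinct js \<and> set js = S \<and> ?\<alpha> (map \<e> js) = 0" if "card S = 5" for S :: "6 set"
  proof -
    have "card (- S) = 1"
      using that by (simp add: Compl_eq_Diff_UNIV card_Diff_subset)
    then obtain m where m: "S = - {m}"
      by (metis card_1_singletonE double_compl)
    have compl: "- {m} = {1, 2, 3, 4, 5, 6} - {m}" for m :: 6
      using UNIV_6 by auto
    have "m \<in> {1, 2, 3, 4, 5, 6}"
      using UNIV_6 by auto
    then show ?thesis
      unfolding m compl
      by (elim insertE emptyE)
       (rule exI conjI, rule conjI[OF _ conjI[OF _ basis(1)]] conjI[OF _ conjI[OF _ basis(2)]]
         conjI[OF _ conjI[OF _ basis(3)]] conjI[OF _ conjI[OF _ basis(4)]] conjI[OF _ conjI[OF _ basis(5)]]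
         conjI[OF _ conjI[OF _ basis(6)]]; force)+
  qed
  then have "?\<alpha> xs = 0" if "length xs = 5" for xs
    using alternating_form_eq_0[OF alternating_ext_d_square[OF bilinear_g2 g2_br_self form] _ that]
    by blast
  then show ?thesis
    by (simp add: closed_form_def)
qed

section \<open>The paracomplex structure and its associated metrics\<close>

lemma linear_P0: "linear P0"
  by (rule linearI) (simp_all add: vec_eq_iff forall_6 P0_nth)

lemma P0_P0: "P0 \<circ> P0 = id"
  by (simp add: fun_eq_iff vec_eq_iff forall_6 P0_nth)

text \<open>The eigenspaces are the two factors of the semidirect product: the ideal h_3 for the
  eigenvalue 1 and the subalgebra sl(2,R) for -1.\<close>

lemma paracomplex_P0: "paracomplex g2_br P0"
proof -
  have plus: "{X. P0 X = X} = {X. X $ 4 = 0 \<and> X $ 5 = 0 \<and> X $ 6 = 0}"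
    and minus: "{X. P0 X = - X} = {X. X $ 1 = 0 \<and> X $ 2 = 0 \<and> X $ 3 = 0}"
    by (auto simp: vec_eq_iff forall_6 P0_nth)
  \<comment> \<open>Shifting the indices by 3 exchanges the two eigenspaces.\<close>
  define f :: "real^6 \<Rightarrow> real^6" where "f = (\<lambda>X. \<chi> i. X $ (i + 3))"
  have f_nth: "f X $ i = X $ (i + 3)" for X i
    by (simp add: f_def)
  have lin: "linear f"
    by (rule linearI) (simp_all add: vec_eq_iff f_nth)
  have ff: "f (f X) = X" for X
  proof -
    \<comment> \<open>Index arithmetic is modulo 6, which makes the shift an involution.\<close>
    have "i + 3 + 3 = i" for i :: 6 by simp
    then show ?thesis unfolding vec_eq_iff f_nth by metis
  qed
  have "f ` {X. P0 X = X} = {X. P0 X = - X}"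
  proof -
    have "f X \<in> {X. P0 X = - X}" if "X \<in> {X. P0 X = X}" for X
      using that unfolding plus minus by (simp add: f_nth)
    moreover have "f X \<in> {X. P0 X = X}" if "X \<in> {X. P0 X = - X}" for X
    proof -
      have "4 + 3 = (1::6)" "5 + 3 = (2::6)" "6 + 3 = (3::6)" by simp_all
      then show ?thesis
        using that unfolding plus minus mem_Collect_eq f_nth by metis
    qed
    ultimately show ?thesis
      using ff by (metis (no_types, lifting) image_eqI subsetI subset_antisym image_subsetI)
  qed
  moreover have "inj f"
    by (metis ff injI)
  ultimately have "dim {X. P0 X = X} = dim {X. P0 X = - X}"
    using dim_image_eq[OF lin, of "{X. P0 X = X}"] inj_on_subset by (metis subset_UNIV)
  moreover have "subspace {X. P0 X = X}" "subspace {X. P0 X = - X}"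
    unfolding plus minus by (auto simp: subspace_def)
  moreover have "g2_br X Y \<in> {X. P0 X = X}" if "X \<in> {X. P0 X = X}" "Y \<in> {X. P0 X = X}" for X Y
    using that unfolding plus by (simp add: g2_br_nth)
  moreover have "g2_br X Y \<in> {X. P0 X = - X}" if "X \<in> {X. P0 X = - X}" "Y \<in> {X. P0 X = - X}" for X Y
    using that unfolding minus by (simp add: g2_br_nth)
  ultimately show ?thesis
    using linear_P0 P0_P0 by (simp add: paracomplex_def subalgebra_def)
qed

text \<open>Symmetry is the chain \<omega>(X,PY) = \<omega>(PPX,PY) = -\<omega>(PX,Y) =
  \<omega>(Y,PX). Nondegeneracy is inherited from \<omega> because \<open>P\<close> is onto.\<close>

lemma pseudo_riemannian_assoc_metric:
  assumes form: "is_form 2 \<omega>" and nondeg: "nondegenerate_form \<omega>" and compat: "compatible \<omega> P"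
    and P: "linear P" "P \<circ> P = id"
  shows "pseudo_riemannian (assoc_metric \<omega> P)"
proof -
  note bil = is_form_2D(1)[OF form]
  have PP: "P (P X) = X" for X
    using P(2) by (metis comp_apply id_apply)
  have "bilinear (assoc_metric \<omega> P)"
    unfolding bilinear_def assoc_metric_def
    by (auto intro!: linearI simp: bilinear_ladd[OF bil] bilinear_radd[OF bil] bilinear_lmul[OF bil]
        bilinear_rmul[OF bil] linear_add[OF P(1)] linear_cmul[OF P(1)])
  moreover have "assoc_metric \<omega> P X Y = assoc_metric \<omega> P Y X" for X Y
  proof -
    have "\<omega> [X, P Y] = \<omega> [P (P X), P Y]" by (simp add: PP)
    also have "\<dots> = - \<omega> [P X, Y]" using compat by (simp add: compatible_def)
    also have "\<dots> = \<omega> [Y, P X]" using is_form_2D(3)[OF form, of Y "P X"] by simp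
    finally show ?thesis by (simp add: assoc_metric_def)
  qed
  moreover have "nondegenerate (assoc_metric \<omega> P)"
    using nondeg unfolding nondegenerate_form_def nondegenerate_def assoc_metric_def
    by (metis PP)
  ultimately show ?thesis
    by (simp add: pseudo_riemannian_def)
qed

section \<open>Forms pairing the two eigenspaces, and the three families\<close>

lemma is_form_mixed:
  assumes \<omega>: "\<And>X Y. \<omega> [X, Y] = (\<Sum>i\<in>{1, 2, 3}. \<Sum>j\<in>{4, 5, 6::6}. c i j * (X $ i * Y $ j - X $ j * Y $ i))"
  shows "is_form 2 \<omega>"
proof (rule is_form_2I)
  show "bilinear (\<lambda>X Y. \<omega> [X, Y])"
    unfolding bilinear_def \<omega>
    by (auto intro!: linearI simp: sum.distrib[symmetric] sum_distrib_left algebra_simps)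
qed (simp add: \<omega>)

lemma compatible_mixed:
  assumes \<omega>: "\<And>X Y. \<omega> [X, Y] = (\<Sum>i\<in>{1, 2, 3}. \<Sum>j\<in>{4, 5, 6::6}. c i j * (X $ i * Y $ j - X $ j * Y $ i))"
  shows "compatible \<omega> P0"
  unfolding compatible_def \<omega> by (simp add: P0_nth algebra_simps)

text \<open>The common criterion for the three families: beyond nondegeneracy, only two quadratic
  equations in the coefficients remain to be checked.\<close>

lemma semi_para_kaehler_mixed:
  assumes mixed: "\<And>X Y. \<omega> [X, Y] =
      (\<Sum>i\<in>{1, 2, 3}. \<Sum>j\<in>{4, 5, 6}. \<omega> [\<e> i, \<e> j] * (X $ i * Y $ j - X $ j * Y $ i))"
    and nondeg: "nondegenerate_form \<omega>"
    and eq1: "\<omega> [\<e> 1, \<e> 5] * \<omega> [\<e> 3, \<e> 6] + \<omega> [\<e> 2, \<e> 4] * \<omega> [\<e> 3, \<e> 5]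
      = \<omega> [\<e> 1, \<e> 6] * \<omega> [\<e> 3, \<e> 5] + \<omega> [\<e> 2, \<e> 5] * \<omega> [\<e> 3, \<e> 4]"
    and eq2: "\<omega> [\<e> 2, \<e> 5] * \<omega> [\<e> 3, \<e> 6] + \<omega> [\<e> 1, \<e> 4] * \<omega> [\<e> 3, \<e> 6]
      = \<omega> [\<e> 2, \<e> 6] * \<omega> [\<e> 3, \<e> 5] + \<omega> [\<e> 1, \<e> 6] * \<omega> [\<e> 3, \<e> 4]"
  shows "semi_para_kaehler g2_br \<omega> P0 (assoc_metric \<omega> P0)"
proof -
  have form: "is_form 2 \<omega>"
    using mixed by (rule is_form_mixed)
  have compat: "compatible \<omega> P0"
    using mixed by (rule compatible_mixed)
  have "closed_form g2_br 4 (wedge 2 2 \<omega> \<omega>)"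
    using form compat eq1 eq2 by (rule closed_square_if_compatible)
  then show ?thesis
    using paracomplex_P0 form nondeg compat
      pseudo_riemannian_assoc_metric[OF form nondeg compat linear_P0 P0_P0]
    by (simp add: semi_para_kaehler_def semi_kaehler_def)
qed

text \<open>The degrees are put as \<open>Suc 0\<close>, the shape into which the simplifier
  rewrites \<open>1\<close>.\<close>

lemmas form_eval = wedge11_apply[unfolded One_nat_def] form_scale_def dual_basis_def axis_def

text \<open>For \<open>w 3 6 \<noteq> 0\<close> the second quadratic equation is solved for the
  coefficient of e^1 \<and> e^4 and the first for that of e^1 \<and> e^5; these are the fractions in
  \<open>omega1\<close>.\<close>

lemma semi_para_kaehler_omega1:
  assumes "w 3 6 \<noteq> 0" and "nondegenerate_form (omega1 w)"
  shows "semi_para_kaehler g2_br (omega1 w) P0 (assoc_metric (omega1 w) P0)"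
proof (rule semi_para_kaehler_mixed)
  show "nondegenerate_form (omega1 w)" by fact
next
  show "omega1 w [X, Y] = (\<Sum>i\<in>{1, 2, 3}. \<Sum>j\<in>{4, 5, 6}.
      omega1 w [\<e> i, \<e> j] * (X $ i * Y $ j - X $ j * Y $ i))" for X Y
    by (simp add: omega1_def form_eval divide_inverse algebra_simps)
qed (use assms(1) in \<open>simp_all add: omega1_def form_eval field_simps\<close>)

text \<open>Here the coefficient of e^3 \<and> e^6 is zero. With \<open>w 3 5 \<noteq> 0\<close> the
  first equation then determines the coefficient of e^1 \<and> e^6 and the second that of e^2 \<and>
  e^6.\<close>

lemma semi_para_kaehler_omega2:
  assumes "w 3 5 \<noteq> 0" and "nondegenerate_form (omega2 w)"
  shows "semi_para_kaehler g2_br (omega2 w) P0 (assoc_metric (omega2 w) P0)"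
proof (rule semi_para_kaehler_mixed)
  show "nondegenerate_form (omega2 w)" by fact
next
  show "omega2 w [X, Y] = (\<Sum>i\<in>{1, 2, 3}. \<Sum>j\<in>{4, 5, 6}.
      omega2 w [\<e> i, \<e> j] * (X $ i * Y $ j - X $ j * Y $ i))" for X Y
    by (simp add: omega2_def form_eval divide_inverse algebra_simps)
qed (use assms(1) in \<open>simp_all add: omega2_def form_eval field_simps power2_eq_square\<close>)

text \<open>The coefficients with indices 16, 25, 35 and 36 are zero, and every product in the two
  equations contains one of them.\<close>

lemma semi_para_kaehler_omega3:
  assumes "nondegenerate_form (omega3 w)"
  shows "semi_para_kaehler g2_br (omega3 w) P0 (assoc_metric (omega3 w) P0)"
proof (rule semi_para_kaehler_mixed)
  show "nondegenerate_form (omega3 w)" by fact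
next
  show "omega3 w [X, Y] = (\<Sum>i\<in>{1, 2, 3}. \<Sum>j\<in>{4, 5, 6}.
      omega3 w [\<e> i, \<e> j] * (X $ i * Y $ j - X $ j * Y $ i))" for X Y
    by (simp add: omega3_def form_eval algebra_simps)
qed (simp_all add: omega3_def form_eval)

section \<open>Nondegeneracy and explicit members of the families\<close>

lemma nondegenerate_form_basisI:
  fixes \<omega> :: "'n::finite form"
  assumes "\<And>X. (\<And>i. \<omega> [X, axis i 1] = 0) \<Longrightarrow> X = 0"
  shows "nondegenerate_form \<omega>"
  using assms unfolding nondegenerate_form_def nondegenerate_def by blast

lemma nondegenerate_Omega0: "nondegenerate_form Omega01" "nondegenerate_form Omega02"
proof -
  show "nondegenerate_form Omega01"
  proof (rule nondegenerate_form_basisI)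
    fix X assume *: "\<And>i. Omega01 [X, \<e> i] = 0"
    show "X = 0"
      using *[of 1] *[of 2] *[of 3] *[of 4] *[of 5] *[of 6]
      by (simp add: Omega01_def form_eval vec_eq_iff forall_6)
  qed
  show "nondegenerate_form Omega02"
  proof (rule nondegenerate_form_basisI)
    fix X assume *: "\<And>i. Omega02 [X, \<e> i] = 0"
    show "X = 0"
      using *[of 1] *[of 2] *[of 3] *[of 4] *[of 5] *[of 6]
      by (simp add: Omega02_def form_eval vec_eq_iff forall_6)
  qed
qed

lemma Omega0_in_family1: "Omega01 \<in> family1" "Omega02 \<in> family1"
proof -
  \<comment> \<open>With \<open>w 3 6 = 1\<close>, \<open>w 2 5 = 1\<close> or \<open>-1\<close> and
    all other parameters zero, the fraction at e^1 \<and> e^4 in \<open>omega1\<close> becomes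
    \<open>- w 2 5\<close>.\<close>
  define w1 w2 :: "nat \<Rightarrow> nat \<Rightarrow> real"
    where "w1 = (\<lambda>i j. of_bool ((i, j) \<in> {(2, 5), (3, 6)}))"
      and "w2 = (\<lambda>i j. of_bool ((i, j) = (3, 6)) - of_bool ((i, j) = (2, 5)))"
  have "Omega01 = omega1 w1" "Omega02 = omega1 w2"
    by (simp_all add: fun_eq_iff Omega01_def Omega02_def omega1_def form_eval w1_def w2_def)
  moreover have "w1 3 6 \<noteq> 0" "w2 3 6 \<noteq> 0"
    by (simp_all add: w1_def w2_def)
  ultimately show "Omega01 \<in> family1" "Omega02 \<in> family1"
    using nondegenerate_Omega0 unfolding family1_def mem_Collect_eq by metis+
qed

lemma family2_nonempty: "family2 \<noteq> {}"
proof -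
  \<comment> \<open>This choice gives the form e^1 \<and> e^6 + e^2 \<and> e^4 + e^3 \<and>
    e^5.\<close>
  define w :: "nat \<Rightarrow> nat \<Rightarrow> real" where "w = (\<lambda>i j. of_bool ((i, j) \<in> {(2, 4), (3, 5)}))"
  have "nondegenerate_form (omega2 w)"
  proof (rule nondegenerate_form_basisI)
    fix X assume *: "\<And>i. omega2 w [X, \<e> i] = 0"
    show "X = 0"
      using *[of 1] *[of 2] *[of 3] *[of 4] *[of 5] *[of 6]
      by (simp add: omega2_def form_eval w_def vec_eq_iff forall_6)
  qed
  moreover have "w 3 5 \<noteq> 0"
    by (simp add: w_def)
  ultimately show ?thesis
    unfolding family2_def by blast
qed

lemma family3_nonempty: "family3 \<noteq> {}"
proof -
  define w :: "nat \<Rightarrow> nat \<Rightarrow> real" where "w = (\<lambda>i j. of_bool ((i, j) \<in> {(1, 5), (2, 6), (3, 4)}))"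
  have "nondegenerate_form (omega3 w)"
  proof (rule nondegenerate_form_basisI)
    fix X assume *: "\<And>i. omega3 w [X, \<e> i] = 0"
    show "X = 0"
      using *[of 1] *[of 2] *[of 3] *[of 4] *[of 5] *[of 6]
      by (simp add: omega3_def form_eval w_def vec_eq_iff forall_6)
  qed
  then show ?thesis
    unfolding family3_def by blast
qed

section \<open>Scalar curvature\<close>

text \<open>The difference of two such connections, lowered with \<open>g\<close>, is symmetric in
  its first two arguments (torsion) and skew in its last two (metricity), hence zero.\<close>

lemma is_levi_civita_unique:
  assumes g: "pseudo_riemannian g"
    and D: "is_levi_civita br g D" "is_levi_civita br g D'"
  shows "D = D'"
proof (intro ext)
  fix X Y
  have bil: "bilinear g" and sym: "\<And>X Y. g X Y = g Y X" and nondeg: "nondegenerate g"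
    using g by (auto simp: pseudo_riemannian_def)
  define t where "t = (\<lambda>X Y Z. g (D X Y - D' X Y) Z)"
  have t12: "t X Y Z = t Y X Z" for X Y Z
  proof -
    have "D X Y - D Y X = br X Y" "D' X Y - D' Y X = br X Y"
      using D by (auto simp: is_levi_civita_def)
    then have "D X Y - D' X Y = D Y X - D' Y X"
      by (simp add: algebra_simps)
    then show ?thesis
      by (simp add: t_def)
  qed
  have t23: "t X Y Z = - t X Z Y" for X Y Z
  proof -
    have "g (D X Y) Z + g Y (D X Z) = 0" "g (D' X Y) Z + g Y (D' X Z) = 0"
      using D by (simp_all add: is_levi_civita_def)
    then show ?thesis
      by (simp add: t_def bilinear_lsub[OF bil] sym[of _ Y])
  qed
  have "t X Y Z = 0" for Z
    \<comment> \<open>Alternating the two symmetries six times returns to \<open>t X Y Z\<close>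
      after three sign changes.\<close>
    using t12[of X Y Z] t23[of Y X Z] t12[of Y Z X] t23[of Z Y X] t12[of Z X Y] t23[of X Z Y]
    by linarith
  then have "D X Y - D' X Y = 0"
    using nondeg unfolding t_def nondegenerate_def by blast
  then show "D X Y = D' X Y" by simp
qed

lemma levi_civita_eqI:
  assumes "pseudo_riemannian g" and "is_levi_civita br g D"
  shows "levi_civita br g = D"
  unfolding levi_civita_def
  using assms is_levi_civita_unique by (intro the_equality) blast+

text \<open>\<open>matrix_inv\<close> is a choice among two-sided inverses, so evaluating it rests
  on their uniqueness.\<close>

lemma matrix_inv_eqI:
  fixes A :: "'a::semiring_1^'n^'n"
  assumes "A ** B = mat 1" and "B ** A = mat 1"
  shows "matrix_inv A = B"
proof -
  have "\<exists>A'. A ** A' = mat 1 \<and> A' ** A = mat 1"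
    using assms by blast
  then have "A ** matrix_inv A = mat 1 \<and> matrix_inv A ** A = mat 1"
    unfolding matrix_inv_def by (rule someI_ex)
  then have "matrix_inv A ** (A ** B) = B"
    by (simp add: matrix_mul_assoc)
  then show ?thesis
    by (simp add: assms(1))
qed

section \<open>The metrics of \<open>Omega01\<close> and \<open>Omega02\<close>, their connection
  and curvature\<close>

lemma axis_1_nth: "axis i (1::real) $ j = (if j = i then 1 else 0)"
  by (simp add: axis_def)

text \<open>The value \<open>s = 1\<close> belongs to \<open>Omega01\<close> and
  \<open>s = - 1\<close> to \<open>Omega02\<close>; the term in the indices 3 and 6 is common to
  both.\<close>

definition g2_metric :: "real \<Rightarrow> real^6 \<Rightarrow> real^6 \<Rightarrow> real" where
  "g2_metric s X Y =
     s * (X $ 1 * Y $ 4 + X $ 4 * Y $ 1 - X $ 2 * Y $ 5 - X $ 5 * Y $ 2) - (X $ 3 * Y $ 6 + X $ 6 * Y $ 3)"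

lemma g2_metric_basis:
  "g2_metric s (\<e> 1) (\<e> 1) = 0" "g2_metric s (\<e> 1) (\<e> 2) = 0" "g2_metric s (\<e> 1) (\<e> 3) = 0"
  "g2_metric s (\<e> 1) (\<e> 4) = s" "g2_metric s (\<e> 1) (\<e> 5) = 0" "g2_metric s (\<e> 1) (\<e> 6) = 0"
  "g2_metric s (\<e> 2) (\<e> 1) = 0" "g2_metric s (\<e> 2) (\<e> 2) = 0" "g2_metric s (\<e> 2) (\<e> 3) = 0"
  "g2_metric s (\<e> 2) (\<e> 4) = 0" "g2_metric s (\<e> 2) (\<e> 5) = - s" "g2_metric s (\<e> 2) (\<e> 6) = 0"
  "g2_metric s (\<e> 3) (\<e> 1) = 0" "g2_metric s (\<e> 3) (\<e> 2) = 0" "g2_metric s (\<e> 3) (\<e> 3) = 0"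
  "g2_metric s (\<e> 3) (\<e> 4) = 0" "g2_metric s (\<e> 3) (\<e> 5) = 0" "g2_metric s (\<e> 3) (\<e> 6) = - 1"
  "g2_metric s (\<e> 4) (\<e> 1) = s" "g2_metric s (\<e> 4) (\<e> 2) = 0" "g2_metric s (\<e> 4) (\<e> 3) = 0"
  "g2_metric s (\<e> 4) (\<e> 4) = 0" "g2_metric s (\<e> 4) (\<e> 5) = 0" "g2_metric s (\<e> 4) (\<e> 6) = 0"
  "g2_metric s (\<e> 5) (\<e> 1) = 0" "g2_metric s (\<e> 5) (\<e> 2) = - s" "g2_metric s (\<e> 5) (\<e> 3) = 0"
  "g2_metric s (\<e> 5) (\<e> 4) = 0" "g2_metric s (\<e> 5) (\<e> 5) = 0" "g2_metric s (\<e> 5) (\<e> 6) = 0"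
  "g2_metric s (\<e> 6) (\<e> 1) = 0" "g2_metric s (\<e> 6) (\<e> 2) = 0" "g2_metric s (\<e> 6) (\<e> 3) = - 1"
  "g2_metric s (\<e> 6) (\<e> 4) = 0" "g2_metric s (\<e> 6) (\<e> 5) = 0" "g2_metric s (\<e> 6) (\<e> 6) = 0"
  by (simp_all add: g2_metric_def axis_1_nth)

text \<open>The solution of the Koszul formula 2 g(D_X Y, Z) = g([X,Y],Z) - g([Y,Z],X) + g([Z,X],Y)
  for \<open>g2_metric s\<close>, where 1/s is written as \<open>s\<close> since s = 1 or s =
  -1.\<close>

definition g2_nabla :: "real \<Rightarrow> real^6 \<Rightarrow> real^6 \<Rightarrow> real^6" where
  "g2_nabla s X Y =
     (- X $ 2 * Y $ 5 + s * X $ 3 * Y $ 6 + X $ 4 * Y $ 1 + s * X $ 6 * Y $ 3) *\<^sub>R \<e> 1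
   + (- X $ 1 * Y $ 6 - X $ 2 * Y $ 4 - 2 * X $ 4 * Y $ 2) *\<^sub>R \<e> 2
   + (X $ 1 * Y $ 2 / 2 + s * X $ 1 * Y $ 5 - X $ 2 * Y $ 1 / 2 + X $ 3 * Y $ 4 + X $ 4 * Y $ 3
        + s * X $ 5 * Y $ 1) *\<^sub>R \<e> 3
   + (- s * X $ 2 * Y $ 6 / 2 - X $ 4 * Y $ 4 + X $ 5 * Y $ 6 - s * X $ 6 * Y $ 2 / 2) *\<^sub>R \<e> 4
   + (- s * X $ 1 * Y $ 6 / 2 + 2 * X $ 4 * Y $ 5 - s * X $ 6 * Y $ 1 / 2) *\<^sub>R \<e> 5
   + (X $ 6 * Y $ 4 - X $ 4 * Y $ 6) *\<^sub>R \<e> 6"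

lemma g2_nabla_nth:
  "g2_nabla s X Y $ 1 = - X $ 2 * Y $ 5 + s * X $ 3 * Y $ 6 + X $ 4 * Y $ 1 + s * X $ 6 * Y $ 3"
  "g2_nabla s X Y $ 2 = - X $ 1 * Y $ 6 - X $ 2 * Y $ 4 - 2 * X $ 4 * Y $ 2"
  "g2_nabla s X Y $ 3 = X $ 1 * Y $ 2 / 2 + s * X $ 1 * Y $ 5 - X $ 2 * Y $ 1 / 2 + X $ 3 * Y $ 4
     + X $ 4 * Y $ 3 + s * X $ 5 * Y $ 1"
  "g2_nabla s X Y $ 4 = - s * X $ 2 * Y $ 6 / 2 - X $ 4 * Y $ 4 + X $ 5 * Y $ 6 - s * X $ 6 * Y $ 2 / 2"
  "g2_nabla s X Y $ 5 = - s * X $ 1 * Y $ 6 / 2 + 2 * X $ 4 * Y $ 5 - s * X $ 6 * Y $ 1 / 2"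
  "g2_nabla s X Y $ 6 = X $ 6 * Y $ 4 - X $ 4 * Y $ 6"
  by (simp_all add: g2_nabla_def axis_1_nth)

lemma g2_nabla_basis:
  "g2_nabla s (\<e> 1) (\<e> 1) = 0" "g2_nabla s (\<e> 1) (\<e> 2) = (1 / 2) *\<^sub>R \<e> 3" "g2_nabla s (\<e> 1) (\<e> 3) = 0"
  "g2_nabla s (\<e> 1) (\<e> 4) = 0" "g2_nabla s (\<e> 1) (\<e> 5) = s *\<^sub>R \<e> 3" "g2_nabla s (\<e> 1) (\<e> 6) = - \<e> 2 - (s / 2) *\<^sub>R \<e> 5"
  "g2_nabla s (\<e> 2) (\<e> 1) = - (1 / 2) *\<^sub>R \<e> 3" "g2_nabla s (\<e> 2) (\<e> 2) = 0" "g2_nabla s (\<e> 2) (\<e> 3) = 0"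
  "g2_nabla s (\<e> 2) (\<e> 4) = - \<e> 2" "g2_nabla s (\<e> 2) (\<e> 5) = - \<e> 1" "g2_nabla s (\<e> 2) (\<e> 6) = - (s / 2) *\<^sub>R \<e> 4"
  "g2_nabla s (\<e> 3) (\<e> 1) = 0" "g2_nabla s (\<e> 3) (\<e> 2) = 0" "g2_nabla s (\<e> 3) (\<e> 3) = 0"
  "g2_nabla s (\<e> 3) (\<e> 4) = \<e> 3" "g2_nabla s (\<e> 3) (\<e> 5) = 0" "g2_nabla s (\<e> 3) (\<e> 6) = s *\<^sub>R \<e> 1"
  "g2_nabla s (\<e> 4) (\<e> 1) = \<e> 1" "g2_nabla s (\<e> 4) (\<e> 2) = - 2 *\<^sub>R \<e> 2" "g2_nabla s (\<e> 4) (\<e> 3) = \<e> 3"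
  "g2_nabla s (\<e> 4) (\<e> 4) = - \<e> 4" "g2_nabla s (\<e> 4) (\<e> 5) = 2 *\<^sub>R \<e> 5" "g2_nabla s (\<e> 4) (\<e> 6) = - \<e> 6"
  "g2_nabla s (\<e> 5) (\<e> 1) = s *\<^sub>R \<e> 3" "g2_nabla s (\<e> 5) (\<e> 2) = 0" "g2_nabla s (\<e> 5) (\<e> 3) = 0"
  "g2_nabla s (\<e> 5) (\<e> 4) = 0" "g2_nabla s (\<e> 5) (\<e> 5) = 0" "g2_nabla s (\<e> 5) (\<e> 6) = \<e> 4"
  "g2_nabla s (\<e> 6) (\<e> 1) = - (s / 2) *\<^sub>R \<e> 5" "g2_nabla s (\<e> 6) (\<e> 2) = - (s / 2) *\<^sub>R \<e> 4" "g2_nabla s (\<e> 6) (\<e> 3) = s *\<^sub>R \<e> 1"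
  "g2_nabla s (\<e> 6) (\<e> 4) = \<e> 6" "g2_nabla s (\<e> 6) (\<e> 5) = 0" "g2_nabla s (\<e> 6) (\<e> 6) = 0"
  by (simp_all add: vec_eq_iff forall_6 g2_nabla_nth axis_1_nth)

lemma is_levi_civita_g2_nabla:
  assumes s: "s = 1 \<or> s = - 1"
  shows "is_levi_civita g2_br (g2_metric s) (g2_nabla s)"
  unfolding is_levi_civita_def
proof (intro conjI allI)
  show "bilinear (g2_nabla s)"
    unfolding bilinear_def
    by (auto intro!: linearI simp: vec_eq_iff forall_6 g2_nabla_nth field_simps)
next
  fix X Y
  show "g2_nabla s X Y - g2_nabla s Y X = g2_br X Y"
    by (simp add: vec_eq_iff forall_6 g2_nabla_nth g2_br_nth field_simps)
next
  fix X Y Z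
  show "g2_metric s (g2_nabla s X Y) Z + g2_metric s Y (g2_nabla s X Z) = 0"
    using s by (elim disjE) (simp_all add: g2_metric_def g2_nabla_nth field_simps)
qed

lemma ricci_eq:
  assumes "levi_civita br g = D"
  shows "ricci br g Y Z =
    (\<Sum>i\<in>UNIV. (D (axis i 1) (D Y Z) - D Y (D (axis i 1) Z) - D (br (axis i 1) Y) Z) $ i)"
  by (simp add: ricci_def trace_def matrix_def riemann_def Let_def assms)

lemma scalar_curvature_g2_metric:
  assumes s: "s = 1 \<or> s = - 1" and g: "pseudo_riemannian (g2_metric s)"
  shows "scalar_curvature g2_br (g2_metric s) = 0"
proof -
  let ?G = "(\<chi> k l. g2_metric s (\<e> k) (\<e> l)) :: real^6^6"
  have "s * s = 1"
    using s by auto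
  \<comment> \<open>\<open>?G\<close> is a symmetric signed permutation matrix, hence its own
    inverse.\<close>
  then have "?G ** ?G = mat 1"
    by (simp add: matrix_matrix_mult_def mat_def vec_eq_iff forall_6 sum_UNIV_6 g2_metric_basis)
  then have inv: "matrix_inv ?G = ?G"
    by (intro matrix_inv_eqI)
  have bil: "bilinear (g2_nabla s)"
    using is_levi_civita_g2_nabla[OF s] by (simp add: is_levi_civita_def)
  note D_lin = bilinear_lzero[OF bil] bilinear_rzero[OF bil] bilinear_lneg[OF bil] bilinear_rneg[OF bil]
    bilinear_lmul[OF bil] bilinear_rmul[OF bil] bilinear_rsub[OF bil]
  note LC = levi_civita_eqI[OF g is_levi_civita_g2_nabla[OF s]]
  have "ricci g2_br (g2_metric s) (\<e> 1) (\<e> 4) = 0" "ricci g2_br (g2_metric s) (\<e> 4) (\<e> 1) = 0"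
    "ricci g2_br (g2_metric s) (\<e> 2) (\<e> 5) = 0" "ricci g2_br (g2_metric s) (\<e> 5) (\<e> 2) = 0"
    "ricci g2_br (g2_metric s) (\<e> 3) (\<e> 6) = 0" "ricci g2_br (g2_metric s) (\<e> 6) (\<e> 3) = 0"
    by (simp_all add: ricci_eq[OF LC] sum_UNIV_6 g2_br_basis g2_nabla_basis D_lin axis_1_nth)
  then show ?thesis
    unfolding scalar_curvature_def inv by (simp add: sum_UNIV_6 g2_metric_basis)
qed

lemma assoc_metric_Omega0:
  "assoc_metric Omega01 P0 = g2_metric 1" "assoc_metric Omega02 P0 = g2_metric (- 1)"
  by (simp_all add: fun_eq_iff assoc_metric_def Omega01_def Omega02_def form_eval P0_nth g2_metric_def)

theorem theorem3p2:
  shows "(\<nexists>\<omega>. symplectic g2_br \<omega>) \<and>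
    (\<forall>\<Omega>\<in>{Omega01, Omega02}.
       semi_para_kaehler g2_br \<Omega> P0 (assoc_metric \<Omega> P0) \<and>
       scalar_curvature g2_br (assoc_metric \<Omega> P0) = 0) \<and>
    (\<forall>F\<in>{family1, family2, family3}.
       F \<noteq> {} \<and>
       (\<forall>\<omega>\<in>F. semi_kaehler g2_br \<omega> \<and> compatible \<omega> P0 \<and>
          semi_para_kaehler g2_br \<omega> P0 (assoc_metric \<omega> P0)))"
proof -
  have families: "semi_para_kaehler g2_br \<omega> P0 (assoc_metric \<omega> P0)"
    if "\<omega> \<in> family1 \<or> \<omega> \<in> family2 \<or> \<omega> \<in> family3" for \<omega>
    using that
  proof (elim disjE)
    assume "\<omega> \<in> family1"
    then obtain w where "\<omega> = omega1 w" "w 3 6 \<noteq> 0" "nondegenerate_form (omega1 w)"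
      unfolding family1_def by blast
    then show ?thesis
      using semi_para_kaehler_omega1 by simp
  next
    assume "\<omega> \<in> family2"
    then obtain w where "\<omega> = omega2 w" "w 3 5 \<noteq> 0" "nondegenerate_form (omega2 w)"
      unfolding family2_def by blast
    then show ?thesis
      using semi_para_kaehler_omega2 by simp
  next
    assume "\<omega> \<in> family3"
    then obtain w where "\<omega> = omega3 w" "nondegenerate_form (omega3 w)"
      unfolding family3_def by blast
    then show ?thesis
      using semi_para_kaehler_omega3 by simp
  qed
  then have "semi_para_kaehler g2_br Omega01 P0 (assoc_metric Omega01 P0)"
    "semi_para_kaehler g2_br Omega02 P0 (assoc_metric Omega02 P0)"
    using Omega0_in_family1 by blast+
  \<comment> \<open>The structures just obtained supply the pseudo-Riemannian hypothesis under which
    the Levi-Civita connection is identified.\<close>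
  moreover from this have "scalar_curvature g2_br (assoc_metric Omega01 P0) = 0"
    "scalar_curvature g2_br (assoc_metric Omega02 P0) = 0"
    unfolding assoc_metric_Omega0 semi_para_kaehler_def
    by (auto intro!: scalar_curvature_g2_metric)
  moreover have "family1 \<noteq> {}"
    using Omega0_in_family1 by blast
  ultimately show ?thesis
    using families not_symplectic_g2 family2_nonempty family3_nonempty
    by (auto simp: semi_para_kaehler_def)
qed

end
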